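(* Let $s \ge 1$ be an integer, let $a_s(n)$ be the number of leaves among the first $n$ nodes of the infinite labelled tree $\mathcal{F}_s$, and let $\mathcal{A}_s(z)=\sum_{n\ge1} a_s(n)z^n$ be its ordinary generating function. Then, as formal power series, \[ \mathcal{A}_s(z) = \frac{1-z^{s}}{1-z} \left( z + z \sum_{n \ge 1} \prod_{k=1}^{n} z^{s-1} \big(z+z^{2^k}\big) \right). \]
   Context: For an integer $s \ge 0$, the infinite tree $\mathcal{F}_s$ is built as follows. It contains an initial single-node tree (one leaf); for each $h \ge 1$ a complete binary tree with $2^h-1$ nodes, called subtree $h$ (so the trees have sizes $1,1,3,7,15,\ldots$); and for each $h\ge 1$ a super-node $y_h$ consisting of $s$ ordinary nodes (no labelled nodes at all if $s=0$). The right child of $y_h$ is the root of subtree $h$; the left child of $y_h$ is $y_{h-1}$ if $h \ge 2$, and is the initial single-node tree if $h=1$. Labels $1,2,3,\ldots$ are given to the nodes in the following order: the initial single node, the $s$ nodes of $y_1$, the nodes of subtree $1$ in preorder, the $s$ nodes of $y_2$, the nodes of subtree $2$ in preorder, and so on. The leaves of $\mathcal{F}_s$ are the initial single node and the leaves of the subtrees $h\ge1$ (all at the bottom level); all other nodes, including those in super-nodes, are internal. For $n\ge 1$, $d_s(n)=1$ if node $n$ is a leaf and $d_s(n)=0$ otherwise; $d_s(0)=0$. Then $a_s(n)=\sum_{j=0}^n d_s(j)$ is the number of leaves among nodes $1,\ldots,n$. *)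

theory Defs
  imports
    Complex_Main
    "HOL-Library.Tree"
    "HOL-Library.Stream"
    "HOL-Computational_Algebra.Formal_Power_Series"
begin

text \<open>
  The shape of the infinite tree. \<open>Initial\<close> is the initial single-node tree, \<open>Super h\<close> is the
  super-node \<open>y_h\<close> with its \<open>s\<close> ordinary nodes taken together, and \<open>Sub h p\<close> is the node of
  subtree \<open>h\<close> reached from its root along the path \<open>p\<close> (\<open>False\<close> for left, \<open>True\<close> for right).
  The vertices that occur in the tree are \<open>Initial\<close>, \<open>Super h\<close> with \<open>h \<ge> 1\<close>, and \<open>Sub h p\<close> with
  \<open>length p < h\<close>; the values of the functions
  below on other elements of the type are irrelevant.
\<close>

datatype vertex = Initial | Super nat | Sub nat "bool list"

fun left_child :: "vertex \<Rightarrow> vertex option" where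
  "left_child Initial = None"
| "left_child (Super h) = Some (if h \<ge> 2 then Super (h - 1) else Initial)"
| "left_child (Sub h p) = (if length p + 1 < h then Some (Sub h (p @ [False])) else None)"

fun right_child :: "vertex \<Rightarrow> vertex option" where
  "right_child Initial = None"
| "right_child (Super h) = Some (Sub h [])"
| "right_child (Sub h p) = (if length p + 1 < h then Some (Sub h (p @ [True])) else None)"

definition is_leaf :: "vertex \<Rightarrow> bool" where
  "is_leaf v \<longleftrightarrow> left_child v = None \<and> right_child v = None"

text \<open>
  Subtree \<open>h\<close> as a library tree (whose empty trees \<open>\<langle>\<rangle>\<close> are not nodes, so that a leaf of the
  mathematical tree is a node with two empty subtrees). In \<open>subtree_at h k p\<close>, \<open>k\<close> is the number of
  levels at and below the node \<open>Sub h p\<close>.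
\<close>

primrec subtree_at :: "nat \<Rightarrow> nat \<Rightarrow> bool list \<Rightarrow> vertex tree" where
  "subtree_at h 0 p = \<langle>\<rangle>"
| "subtree_at h (Suc k) p =
     \<langle>subtree_at h k (p @ [False]), Sub h p, subtree_at h k (p @ [True])\<rangle>"

definition subtree :: "nat \<Rightarrow> vertex tree" where
  "subtree h = subtree_at h h []"

text \<open>
  The nodes that carry labels: a super-node vertex consists of \<open>s\<close> ordinary nodes, any other vertex
  is itself a single node. A node is represented by its vertex and an index within it.
\<close>

fun nodes_of :: "nat \<Rightarrow> vertex \<Rightarrow> (vertex \<times> nat) list" where
  "nodes_of s (Super h) = map (\<lambda>i. (Super h, i)) [0..<s]"
| "nodes_of s v = [(v, 0)]"

definition block :: "nat \<Rightarrow> nat \<Rightarrow> (vertex \<times> nat) list" where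
  "block s h = concat (map (nodes_of s) (Super h # preorder (subtree h)))"

text \<open>
  All nodes in the order of their labels. Labels start at \<open>1\<close> and stream positions at \<open>0\<close>, so the
  node labelled \<open>n \<ge> 1\<close> is \<open>labelled_nodes s !! (n - 1)\<close>.
\<close>

definition labelled_nodes :: "nat \<Rightarrow> (vertex \<times> nat) stream" where
  "labelled_nodes s = (Initial, 0) ## flat (smap (block s) (fromN 1))"

definition leaf_ind :: "nat \<Rightarrow> nat \<Rightarrow> nat" where
  "leaf_ind s n = (if n \<ge> 1 \<and> is_leaf (fst (labelled_nodes s !! (n - 1))) then 1 else 0)"

definition leaf_count :: "nat \<Rightarrow> nat \<Rightarrow> nat" where
  "leaf_count s n = (\<Sum>j=0..n. leaf_ind s j)"

definition leaf_gf :: "nat \<Rightarrow> rat fps" where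
  "leaf_gf s = Abs_fps (\<lambda>n. if n \<ge> 1 then of_nat (leaf_count s n) else 0)"

text \<open>Consistency of the definitions.\<close>

lemma height_subtree_at [simp]: "height (subtree_at h k p) = k"
  by (induction k arbitrary: p) auto

lemma complete_subtree_at: "Tree.complete (subtree_at h k p)"
  by (induction k arbitrary: p) auto

lemma complete_subtree: "Tree.complete (subtree h)"
  and height_subtree: "height (subtree h) = h"
  by (simp_all add: subtree_def complete_subtree_at)

lemma size_subtree: "size (subtree h) = 2 ^ h - 1"
  using size_if_complete[OF complete_subtree] by (simp add: height_subtree)

lemma set_subtree_at:
  "length p + k = h \<Longrightarrow>
   set_tree (subtree_at h k p) = {Sub h (p @ q) |q. length q < k}"
proof (induction k arbitrary: p)
  case (Suc k)
  have "{Sub h (p @ q) |q. length q < Suc k} =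
      insert (Sub h p) ({Sub h ((p @ [False]) @ q) |q. length q < k} \<union>
                        {Sub h ((p @ [True]) @ q) |q. length q < k})"
    (is "?L = ?R")
  proof (intro equalityI subsetI)
    fix v assume "v \<in> ?L"
    then obtain q where q: "v = Sub h (p @ q)" "length q < Suc k" by blast
    show "v \<in> ?R"
    proof (cases q)
      case (Cons b r)
      then show ?thesis using q by (cases b) auto
    qed (use q in auto)
  next
    fix v assume "v \<in> ?R"
    then consider "v = Sub h p"
      | b q where "v = Sub h ((p @ [b]) @ q)" "length q < k" by blast
    then show "v \<in> ?L"
    proof cases
      case 1
      then show ?thesis by (auto intro: exI[of _ "[]"])
    next
      case (2 b q)
      then show ?thesis by (auto intro!: exI[of _ "b # q"])
    qed
  qed
  with Suc show ?case by auto
qed auto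

lemma set_subtree: "set_tree (subtree h) = {Sub h p |p. length p < h}"
  using set_subtree_at[of "[]" h h] by (simp add: subtree_def)

fun root_node :: "'v tree \<Rightarrow> 'v option" where
  "root_node \<langle>\<rangle> = None"
| "root_node \<langle>l, v, r\<rangle> = Some v"

lemma children_subtree_at:
  "\<lbrakk>length p + k = h; \<langle>l, v, r\<rangle> \<in> subtrees (subtree_at h k p)\<rbrakk>
   \<Longrightarrow> left_child v = root_node l \<and> right_child v = root_node r"
proof (induction k arbitrary: p)
  case (Suc k)
  consider "l = subtree_at h k (p @ [False])" "v = Sub h p" "r = subtree_at h k (p @ [True])"
    | b where "\<langle>l, v, r\<rangle> \<in> subtrees (subtree_at h k (p @ [b]))"
    using Suc.prems by auto
  then show ?case
  proof cases
    case 1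
    then show ?thesis using Suc.prems(1) by (cases k) auto
  next
    case (2 b)
    then show ?thesis using Suc.IH[of "p @ [b]"] Suc.prems(1) by simp
  qed
qed auto

lemma children_subtree:
  "\<langle>l, v, r\<rangle> \<in> subtrees (subtree h) \<Longrightarrow> left_child v = root_node l \<and> right_child v = root_node r"
  using children_subtree_at[of "[]" h h] by (simp add: subtree_def)

lemma root_subtree: "h \<ge> 1 \<Longrightarrow> right_child (Super h) = root_node (subtree h)"
  by (cases h) (auto simp: subtree_def)

lemma block_nonempty: "h \<ge> 1 \<Longrightarrow> block s h \<noteq> []"
  by (cases h) (auto simp: block_def subtree_def)

lemma labelled_nodes_unfold:
  "labelled_nodes s = (Initial, 0) ## block s 1 @- block s 2 @- block s 3 @- flat (smap (block s) (fromN 4))"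
proof -
  have "fromN 1 = 1 ## 2 ## 3 ## fromN 4"
    by (subst siterate.ctr, subst siterate.ctr, subst siterate.ctr) (simp add: eval_nat_numeral)
  then show ?thesis
    by (simp add: labelled_nodes_def block_nonempty)
qed

lemma leaf_count_1: "map (leaf_count 1) [0..<16] = [0,1,1,2,2,2,3,4,4,4,4,5,6,6,7,8]"
  by (simp add: leaf_count_def leaf_ind_def labelled_nodes_unfold block_def subtree_def is_leaf_def
      eval_nat_numeral)

end

theory Submission
  imports Defs
begin

text \<open>
  Let \<open>P\<^sub>n = \<Prod>k=1..n. X ^ s (1 + X ^ (2 ^ k - 1))\<close>. The label indicator of the leaves of subtree \<open>h\<close>
  has generating function \<open>X ^ (s h + 2 ^ h) (\<Prod>k=1..h-1. 1 + X ^ (2 ^ k - 1))\<close>, because the right half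
  of a complete tree repeats its left half, shifted by the size of that half. This function
  equals \<open>X (P\<^sub>h - X ^ s P\<^sub>h\<^sub>-\<^sub>1)\<close>, so the initial node and all subtrees together give
  \<open>X (1 - X ^ s) (\<Sum>n\<ge>0. P\<^sub>n)\<close>. Dividing by \<open>1 - X\<close> turns the indicator into the count.
\<close>

unbundle fps_syntax

lemma fps_mult_nth_cong:
  fixes f g h :: "'a::semiring_0 fps"
  assumes "\<And>i. i \<le> m \<Longrightarrow> f $ i = g $ i"
  shows "(h * f) $ m = (h * g) $ m"
  using assms by (auto simp: fps_mult_nth intro!: sum.cong)

text \<open>Coefficient \<open>m\<close> of the partial sums is constant from \<open>m + 1\<close>
  terms on, which is convergence in the topology of formal power series.\<close>

lemma fps_sums_nth:
  fixes f :: "nat \<Rightarrow> 'a::ab_group_add fps"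
  assumes "\<And>m n. m < n \<Longrightarrow> f n $ m = 0"
  shows "f sums Abs_fps (\<lambda>m. \<Sum>n\<le>m. f n $ m)"
  unfolding sums_def
proof (rule tendsto_fpsI)
  fix m
  have "sum f {..<N} $ m = (\<Sum>n\<le>m. f n $ m)" if "N > m" for N
    unfolding fps_sum_nth using that assms
    by (intro sum.mono_neutral_right) auto
  then show "\<forall>\<^sub>F N in sequentially. sum f {..<N} $ m = Abs_fps (\<lambda>m. \<Sum>n\<le>m. f n $ m) $ m"
    by (auto intro: eventually_mono[OF eventually_gt_at_top[of m]])
qed

text \<open>Exponents are list positions, counted from 0, so that concatenation becomes
  multiplication by a power of \<open>fps_X\<close>. Labels start at 1, hence the extra factor
  \<open>fps_X\<close> in \<open>leaf_ind_eq_nth\<close>.\<close>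

definition leaf_fps :: "(vertex \<times> nat) list \<Rightarrow> rat fps" where
  "leaf_fps xs = (\<Sum>i<length xs. if is_leaf (fst (xs ! i)) then fps_X ^ i else 0)"

lemma leaf_fps_Nil [simp]: "leaf_fps [] = 0"
  by (simp add: leaf_fps_def)

lemma leaf_fps_Cons [simp]:
  "leaf_fps (x # xs) = (if is_leaf (fst x) then 1 else 0) + fps_X * leaf_fps xs"
proof -
  have "(\<Sum>i<length xs. if is_leaf (fst (xs ! i)) then fps_X ^ Suc i else 0 :: rat fps) =
      fps_X * leaf_fps xs"
    unfolding leaf_fps_def sum_distrib_left by (intro sum.cong) auto
  then show ?thesis
    unfolding leaf_fps_def by (simp add: sum.lessThan_Suc_shift del: sum.lessThan_Suc)
qed

lemma leaf_fps_append [simp]: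
  "leaf_fps (xs @ ys) = leaf_fps xs + fps_X ^ length xs * leaf_fps ys"
  by (induction xs) (simp_all add: algebra_simps)

lemma leaf_fps_nth:
  "leaf_fps xs $ m = (if m < length xs \<and> is_leaf (fst (xs ! m)) then 1 else 0)"
proof -
  have "leaf_fps xs $ m =
      (\<Sum>i<length xs. if m = i then (if is_leaf (fst (xs ! i)) then 1 else 0) else 0)"
    unfolding leaf_fps_def fps_sum_nth by (intro sum.cong) auto
  then show ?thesis
    by (auto simp: sum.delta)
qed

lemma leaf_fps_eq_0: "(\<And>x. x \<in> set xs \<Longrightarrow> \<not> is_leaf (fst x)) \<Longrightarrow> leaf_fps xs = 0"
  by (induction xs) auto

lemma length_subtree_nodes:
  "length (concat (map (nodes_of s) (preorder (subtree_at h k p)))) = 2 ^ k - 1"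
proof (induction k arbitrary: p)
  case (Suc k)
  define n :: nat where "n = 2 ^ k - 1"
  have "length (concat (map (nodes_of s) (preorder (subtree_at h (Suc k) p)))) = 1 + n + n"
    by (simp add: Suc.IH [folded n_def] del: length_concat)
  also have "\<dots> = 2 ^ Suc k - 1"
    using one_le_power[of "2::nat" k] unfolding n_def power_Suc by linarith
  finally show ?case .
qed simp

lemma leaf_fps_subtree_nodes:
  "length p + Suc k = h \<Longrightarrow>
   leaf_fps (concat (map (nodes_of s) (preorder (subtree_at h (Suc k) p)))) =
     fps_X ^ k * (\<Prod>j=1..k. 1 + fps_X ^ (2 ^ j - 1))"
proof (induction k arbitrary: p)
  case (Suc k)
  have "\<not> is_leaf (Sub h p)"
    using Suc.prems by (simp add: is_leaf_def)
  then show ?case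
    using Suc.IH[of "p @ [False]"] Suc.IH[of "p @ [True]"] Suc.prems
    \<comment> \<open>Unfolding only the outer level leaves both halves in the form of the induction
      hypothesis.\<close>
    by (subst subtree_at.simps)
      (simp add: length_subtree_nodes algebra_simps del: subtree_at.simps)
qed (simp add: is_leaf_def)

lemma length_block: "length (block s h) = s + (2 ^ h - 1)"
  by (simp add: block_def subtree_def length_subtree_nodes del: length_concat)

lemma leaf_fps_block:
  "leaf_fps (block s (Suc h)) = fps_X ^ (s + h) * (\<Prod>j=1..h. 1 + fps_X ^ (2 ^ j - 1))"
proof -
  have "leaf_fps (nodes_of s (Super (Suc h))) = 0"
    by (rule leaf_fps_eq_0) (auto simp: is_leaf_def)
  then show ?thesis
    by (simp add: block_def subtree_def leaf_fps_subtree_nodes power_add mult.assoc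
        del: subtree_at.simps)
qed

definition node_prefix :: "nat \<Rightarrow> nat \<Rightarrow> (vertex \<times> nat) list" where
  "node_prefix s h = (Initial, 0) # concat (map (block s) [1..<Suc h])"

lemma node_prefix_0 [simp]: "node_prefix s 0 = [(Initial, 0)]"
  by (simp add: node_prefix_def)

lemma node_prefix_Suc [simp]: "node_prefix s (Suc h) = node_prefix s h @ block s (Suc h)"
  by (simp add: node_prefix_def)

text \<open>Written additively to avoid subtraction on naturals.\<close>

lemma length_node_prefix: "length (node_prefix s h) + h + 1 = s * h + 2 ^ Suc h"
proof (induction h)
  case (Suc h)
  have "length (block s (Suc h)) + 1 = s + 2 ^ Suc h"
    by (simp add: length_block)
  with Suc show ?case by simp
qed simp

text \<open>\<open>flat\<close> can be unfolded at a nonempty list, and \<open>a \<ge> 1\<close>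
  makes every block nonempty.\<close>

lemma flat_block_fromN:
  "a \<ge> 1 \<Longrightarrow> flat (smap (block s) (fromN a)) =
     concat (map (block s) [a..<a + h]) @- flat (smap (block s) (fromN (a + h)))"
proof (induction h)
  case (Suc h)
  have "fromN (a + h) = (a + h) ## fromN (Suc (a + h))"
    by (subst siterate.ctr) simp
  with Suc show ?case by (simp add: block_nonempty)
qed simp

lemma labelled_nodes_snth:
  assumes "m < length (node_prefix s h)"
  shows "labelled_nodes s !! m = node_prefix s h ! m"
proof -
  have "labelled_nodes s = node_prefix s h @- flat (smap (block s) (fromN (1 + h)))"
    using flat_block_fromN[of 1 s h] by (simp add: labelled_nodes_def node_prefix_def)
  then show ?thesis using assms by simp
qed

lemma leaf_ind_eq_nth:
  assumes "n \<le> length (node_prefix s h)"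
  shows "of_nat (leaf_ind s n) = (fps_X * leaf_fps (node_prefix s h)) $ n"
  using assms labelled_nodes_snth[of "n - 1" s h]
  by (cases n) (auto simp: leaf_ind_def leaf_fps_nth)

definition path_prod :: "nat \<Rightarrow> nat \<Rightarrow> rat fps" where
  "path_prod s n = (\<Prod>k=1..n. fps_X ^ (s - 1) * (fps_X + fps_X ^ (2 ^ k)))"

text \<open>The \<open>fps_X\<close> split off each binomial completes
  \<open>fps_X ^ (s - 1)\<close> to \<open>fps_X ^ s\<close>; this is where \<open>s \<ge> 1\<close>
  enters.\<close>

lemma path_prod_eq:
  assumes "s \<ge> 1"
  shows "path_prod s n = fps_X ^ (s * n) * (\<Prod>k=1..n. 1 + fps_X ^ (2 ^ k - 1))"
proof -
  have "fps_X ^ (s - 1) * (fps_X + fps_X ^ (2 ^ k)) =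
      fps_X ^ s * (1 + fps_X ^ (2 ^ k - 1) :: rat fps)" for k
  proof -
    obtain t where "s = Suc t" using assms by (cases s) auto
    moreover obtain q where "(2::nat) ^ k = Suc q"
      by (metis not0_implies_Suc power_not_zero zero_neq_numeral)
    ultimately show ?thesis by (simp add: algebra_simps)
  qed
  then show ?thesis
    by (simp add: path_prod_def prod.distrib power_mult)
qed

lemma path_prod_nth_0: "s \<ge> 1 \<Longrightarrow> m < n \<Longrightarrow> path_prod s n $ m = 0"
  by (subst path_prod_eq) (auto simp: fps_X_power_mult_nth intro: less_le_trans)

text \<open>Block \<open>h + 1\<close> contributes
  \<open>path_prod s (Suc h) - fps_X ^ s * path_prod s h\<close>. The last summand compensates for
  the final product, which no later block has yet reduced.\<close>

lemma leaf_fps_node_prefix: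
  assumes "s \<ge> 1"
  shows "leaf_fps (node_prefix s h) =
    (1 - fps_X ^ s) * (\<Sum>n\<le>h. path_prod s n) + fps_X ^ s * path_prod s h"
proof (induction h)
  case 0
  show ?case by (simp add: is_leaf_def path_prod_def)
next
  case (Suc h)
  \<comment> \<open>The shift of the new block splits off the exponent of the factor
    \<open>j = Suc h\<close>, and \<open>fps_X ^ (2 ^ Suc h - 1)\<close> is that factor minus
    1.\<close>
  have "length (node_prefix s h) + (s + h) = s * Suc h + (2 ^ Suc h - 1)"
    using length_node_prefix[of s h] by (simp add: algebra_simps)
  then have "fps_X ^ length (node_prefix s h) * fps_X ^ (s + h) =
      (fps_X ^ (s * Suc h) * fps_X ^ (2 ^ Suc h - 1) :: rat fps)"
    by (simp only: power_add [symmetric])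
  then have "leaf_fps (node_prefix s (Suc h)) = leaf_fps (node_prefix s h) +
      fps_X ^ (s * Suc h) * fps_X ^ (2 ^ Suc h - 1) * (\<Prod>j=1..h. 1 + fps_X ^ (2 ^ j - 1))"
    by (simp add: leaf_fps_block mult.assoc [symmetric])
  also have "\<dots> = leaf_fps (node_prefix s h) + path_prod s (Suc h) - fps_X ^ s * path_prod s h"
    using assms by (simp add: path_prod_eq algebra_simps power_add)
  finally show ?case
    by (simp add: Suc.IH algebra_simps)
qed

theorem theorem2p13:
  fixes s :: nat
  assumes "s \<ge> 1"
  shows "summable (\<lambda>n. \<Prod>k=1..Suc n.
           fps_X ^ (s - 1) * (fps_X + fps_X ^ (2 ^ k)) :: rat fps) \<and>
         leaf_gf s = (1 - fps_X ^ s) / (1 - fps_X) *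
           (fps_X + fps_X * (\<Sum>n. \<Prod>k=1..Suc n.
             fps_X ^ (s - 1) * (fps_X + fps_X ^ (2 ^ k))))"
proof -
  define S where "S = Abs_fps (\<lambda>m. \<Sum>n\<le>m. path_prod s (Suc n) $ m)"
  have sums: "(\<lambda>n. path_prod s (Suc n)) sums S"
    unfolding S_def using assms by (intro fps_sums_nth) (simp add: path_prod_nth_0)
  define D where "D = Abs_fps (\<lambda>n. of_nat (leaf_ind s n) :: rat)"
  have S_nth: "(1 + S) $ i = (\<Sum>n\<le>m. path_prod s n) $ i" if "i \<le> m" for i m
  proof -
    \<comment> \<open>Terms with \<open>n > i\<close> vanish. The bound \<open>Suc i\<close> fits
      the shifted index in \<open>S\<close>, and the term \<open>n = 0\<close> is the empty product
      1.\<close>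
    have "(\<Sum>n\<le>m. path_prod s n $ i) = (\<Sum>n\<le>Suc i. path_prod s n $ i)"
    proof (cases "m = i")
      case False
      then show ?thesis
        using that assms by (intro sum.mono_neutral_right) (auto simp: path_prod_nth_0)
    qed (use assms in \<open>simp add: path_prod_nth_0\<close>)
    also have "\<dots> = (1 + S) $ i"
      by (simp add: S_def sum.atMost_Suc_shift path_prod_def del: sum.atMost_Suc)
    finally show ?thesis by (simp add: fps_sum_nth)
  qed
  have "D = (1 - fps_X ^ s) * (fps_X + fps_X * S)"
  proof (rule fps_ext)
    fix m
    \<comment> \<open>Large enough for the prefix to reach label \<open>m\<close> and for the
      compensating term to have no coefficient at \<open>m\<close>.\<close>
    define h where "h = Suc m"
    have "h \<le> s * h" "h < 2 ^ h"
      using assms mult_le_mono1[of 1 s h] by (simp_all add: less_exp)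
    then have "h + h + 1 \<le> s * h + 2 ^ Suc h"
      unfolding power_Suc by linarith
    then have "m \<le> length (node_prefix s h)"
      using length_node_prefix[of s h] unfolding h_def by linarith
    then have "D $ m = (fps_X * leaf_fps (node_prefix s h)) $ m"
      by (simp only: D_def fps_nth_Abs_fps leaf_ind_eq_nth)
    also have "\<dots> = (fps_X * (1 - fps_X ^ s) * (\<Sum>n\<le>h. path_prod s n)) $ m
        + (fps_X ^ Suc s * path_prod s h) $ m"
      using assms by (simp add: leaf_fps_node_prefix algebra_simps)
    also have "(fps_X ^ Suc s * path_prod s h) $ m = 0"
      using assms by (simp add: fps_X_power_mult_nth path_prod_nth_0 h_def del: power_Suc)
    also have "(fps_X * (1 - fps_X ^ s) * (\<Sum>n\<le>h. path_prod s n)) $ m =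
        (fps_X * (1 - fps_X ^ s) * (1 + S)) $ m"
      by (intro fps_mult_nth_cong S_nth [symmetric]) (simp add: h_def)
    finally show "D $ m = ((1 - fps_X ^ s) * (fps_X + fps_X * S)) $ m"
      by (simp add: algebra_simps)
  qed
  \<comment> \<open>Division by \<open>1 - fps_X\<close> forms partial sums of coefficients; at 0
    both sides vanish since \<open>leaf_ind s 0 = 0\<close>.\<close>
  moreover have "leaf_gf s = D / (1 - fps_X)"
    unfolding D_def fps_divide_fps_X_minus1_sum
    by (rule fps_ext) (simp add: leaf_gf_def leaf_count_def leaf_ind_def)
  ultimately have "leaf_gf s = (1 - fps_X ^ s) / (1 - fps_X) * (fps_X + fps_X * S)"
    by (simp add: fps_divide_unit mult.commute mult.left_commute)
  with sums show ?thesis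
    unfolding path_prod_def by (simp add: sums_iff)
qed

end
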